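(* Let $\Gamma_1,\Gamma_2,\Gamma_3$ be nonzero real vorticities. Every equilateral configuration $X_e=(X_1,X_2,X_3)\in\mathcal M$ of three point vortices on the hyperbolic plane is a relative equilibrium. The angular velocity of $X_e$ is $$\xi=\frac{1}{2\pi L}\,\mathbf J(X_1,X_2,X_3),$$ where $\mathbf J(X_1,X_2,X_3)=\Gamma_1X_1+\Gamma_2X_2+\Gamma_3X_3$ and $L=\langle X_i,X_j\rangle_{\mathcal H}^2-1$ for $i\ne j$.
   Context: On $\mathbb{R}^3$ let $\langle X_1,X_2\rangle_{\mathcal H}=x_1x_2+y_1y_2-z_1z_2$ and $X_1\times_{\mathcal H}X_2=(y_1z_2-z_1y_2,\ z_1x_2-x_1z_2,\ -x_1y_2+y_1x_2)$. The hyperbolic plane is $\mathcal H_2=\{(x,y,z)\in\mathbb{R}^3\mid z^2-x^2-y^2=1,\ z>0\}$ with the metric $dx^2+dy^2-dz^2$; hyperbolic distance satisfies $\langle X_1,X_2\rangle_{\mathcal H}=-\cosh d(X_1,X_2)$. The phase space is $\mathcal M=\mathcal H_2^3\setminus\Delta$, where $\Delta$ is the set of configurations in which two or more points coincide. The dynamics is $$\dot X_r=\frac1\pi\sum_{p\ne r}\Gamma_p\frac{X_p\times_{\mathcal H}X_r}{\langle X_r,X_p\rangle_{\mathcal H}^2-1},\qquad r=1,2,3.$$ The group $SL(2,\mathbb{R})$ acts on $\mathbb{R}^3$ by conjugation $\rho\mapsto g\rho g^{-1}$ under the identification $(x,y,z)\leftrightarrow\begin{pmatrix} x & y+z \\ y-z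 & -x \end{pmatrix}$; this preserves $\mathcal H_2$ and acts diagonally on $\mathcal M$. A configuration is equilateral if the three mutual hyperbolic distances are equal. A point $X_e\in\mathcal M$ is a relative equilibrium if the trajectory through $X_e$ is contained in the $SL(2,\mathbb{R})$-orbit of $X_e$. The angular velocity of a relative equilibrium is the vector $\xi\in\mathbb{R}^3$ for which there exist real numbers (Lagrange multipliers) $\lambda_1,\lambda_2,\lambda_3$ such that $$\xi=\frac1{2\pi}\sum_{p\ne r}\Gamma_p\frac{X_p}{\langle X_p,X_r\rangle_{\mathcal H}^2-1}+\frac{\lambda_r}{\Gamma_r}X_r\qquad\text{for all } r\in\{1,2,3\}.$$ *)

theory Defs
  imports "HOL-Analysis.Analysis"
begin

section \<open>The hyperboloid model\<close>

definition hinner :: "real^3 \<Rightarrow> real^3 \<Rightarrow> real" where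
  "hinner u v = u$1 * v$1 + u$2 * v$2 - u$3 * v$3"

definition hcross :: "real^3 \<Rightarrow> real^3 \<Rightarrow> real^3" where
  "hcross u v = vector [u$2 * v$3 - u$3 * v$2,
                        u$3 * v$1 - u$1 * v$3,
                        - (u$1 * v$2) + u$2 * v$1]"

definition hyperbolic_plane :: "(real^3) set" where
  "hyperbolic_plane = {u. (u$3)\<^sup>2 - (u$1)\<^sup>2 - (u$2)\<^sup>2 = 1 \<and> u$3 > 0}"

text \<open>
  The Riemannian distance of the metric \<open>dx\<^sup>2 + dy\<^sup>2 - dz\<^sup>2\<close> restricted to the hyperboloid,
  given by its closed form; \<open>hinner_eq_cosh_hdist\<close> and \<open>hdist_nonneg\<close> below determine it uniquely
  on the hyperbolic plane.
\<close>
definition hdist :: "real^3 \<Rightarrow> real^3 \<Rightarrow> real" where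
  "hdist u v = arcosh (- hinner u v)"

lemma hinner_le_minus_one:
  assumes "u \<in> hyperbolic_plane" "v \<in> hyperbolic_plane"
  shows "hinner u v \<le> - 1"
proof -
  have key: "a * x + b * y + 1 \<le> c * z"
    if u: "c\<^sup>2 - a\<^sup>2 - b\<^sup>2 = 1" "c > 0" and v: "z\<^sup>2 - x\<^sup>2 - y\<^sup>2 = 1" "z > 0"
    for a b c x y z :: real
  proof (rule power2_le_imp_le)
    have "c\<^sup>2 = 1 + a\<^sup>2 + b\<^sup>2" "z\<^sup>2 = 1 + x\<^sup>2 + y\<^sup>2"
      using u(1) v(1) by linarith+
    then have "(c * z)\<^sup>2 = (1 + a\<^sup>2 + b\<^sup>2) * (1 + x\<^sup>2 + y\<^sup>2)"
      by (simp only: power_mult_distrib)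
    also have "\<dots> = (a * x + b * y + 1)\<^sup>2 + ((a - x)\<^sup>2 + (b - y)\<^sup>2 + (a * y - b * x)\<^sup>2)"
      by algebra
    also have "\<dots> \<ge> (a * x + b * y + 1)\<^sup>2"
      by simp
    finally show "(a * x + b * y + 1)\<^sup>2 \<le> (c * z)\<^sup>2" .
    show "0 \<le> c * z"
      using u(2) v(2) by simp
  qed
  show ?thesis
    using key[of "u$3" "u$1" "u$2" "v$3" "v$1" "v$2"] assms
    unfolding hyperbolic_plane_def hinner_def by simp
qed

lemma hinner_eq_cosh_hdist:
  assumes "u \<in> hyperbolic_plane" "v \<in> hyperbolic_plane"
  shows "hinner u v = - cosh (hdist u v)"
  using hinner_le_minus_one[OF assms] by (simp add: hdist_def cosh_arcosh_real)

lemma hdist_nonneg: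
  assumes "u \<in> hyperbolic_plane" "v \<in> hyperbolic_plane"
  shows "hdist u v \<ge> 0"
  using hinner_le_minus_one[OF assms] by (simp add: hdist_def arcosh_nonneg_real)

section \<open>Three point vortices\<close>

text \<open>A configuration is \<open>X :: real^3^3\<close>, where \<open>X$r\<close> is the position of vortex \<open>r\<close>.\<close>

definition phase_space :: "(real^3^3) set" where
  "phase_space = {X. (\<forall>r. X$r \<in> hyperbolic_plane) \<and> (\<forall>r p. r \<noteq> p \<longrightarrow> X$r \<noteq> X$p)}"

definition vortex_field :: "(3 \<Rightarrow> real) \<Rightarrow> real^3^3 \<Rightarrow> real^3^3" where
  "vortex_field \<Gamma> X =
     (\<chi> r. (1 / pi) *\<^sub>R (\<Sum>p | p \<noteq> r. (\<Gamma> p / ((hinner (X$r) (X$p))\<^sup>2 - 1)) *\<^sub>R hcross (X$p) (X$r)))"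

definition equilateral :: "real^3^3 \<Rightarrow> bool" where
  "equilateral X \<longleftrightarrow>
     hdist (X$1) (X$2) = hdist (X$2) (X$3) \<and> hdist (X$2) (X$3) = hdist (X$3) (X$1)"

text \<open>The orbit under the diagonal action of \<open>SL(2,\<real>)\<close> by conjugation.\<close>

definition sl2_mat :: "real^3 \<Rightarrow> real^2^2" where
  "sl2_mat u = vector [vector [u$1, u$2 + u$3], vector [u$2 - u$3, - (u$1)]]"

definition sl2_orbit :: "real^3^3 \<Rightarrow> (real^3^3) set" where
  "sl2_orbit X = {Y. \<exists>g :: real^2^2. det g = 1 \<and>
     (\<forall>r. sl2_mat (Y$r) = g ** sl2_mat (X$r) ** matrix_inv g)}"

definition integral_curve :: "(3 \<Rightarrow> real) \<Rightarrow> real^3^3 \<Rightarrow> real set \<Rightarrow> (real \<Rightarrow> real^3^3) \<Rightarrow> bool" where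
  "integral_curve \<Gamma> X\<^sub>0 I \<phi> \<longleftrightarrow>
     open I \<and> is_interval I \<and> 0 \<in> I \<and> \<phi> 0 = X\<^sub>0 \<and>
     (\<forall>t\<in>I. \<phi> t \<in> phase_space \<and> (\<phi> has_vector_derivative vortex_field \<Gamma> (\<phi> t)) (at t))"

text \<open>
  The trajectory through a point is its maximal integral curve: every other integral curve
  through the point is a restriction of it.
\<close>
definition maximal_integral_curve ::
    "(3 \<Rightarrow> real) \<Rightarrow> real^3^3 \<Rightarrow> real set \<Rightarrow> (real \<Rightarrow> real^3^3) \<Rightarrow> bool" where
  "maximal_integral_curve \<Gamma> X\<^sub>0 I \<phi> \<longleftrightarrow>
     integral_curve \<Gamma> X\<^sub>0 I \<phi> \<and>
     (\<forall>J \<psi>. integral_curve \<Gamma> X\<^sub>0 J \<psi> \<longrightarrow> J \<subseteq> I \<and> (\<forall>t\<in>J. \<psi> t = \<phi> t))"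

definition relative_equilibrium :: "(3 \<Rightarrow> real) \<Rightarrow> real^3^3 \<Rightarrow> bool" where
  "relative_equilibrium \<Gamma> X \<longleftrightarrow>
     X \<in> phase_space \<and> (\<exists>I \<phi>. maximal_integral_curve \<Gamma> X I \<phi> \<and> \<phi> ` I \<subseteq> sl2_orbit X)"

definition is_angular_velocity :: "(3 \<Rightarrow> real) \<Rightarrow> real^3^3 \<Rightarrow> real^3 \<Rightarrow> bool" where
  "is_angular_velocity \<Gamma> X \<xi> \<longleftrightarrow>
     (\<exists>l :: 3 \<Rightarrow> real. \<forall>r.
        \<xi> = (1 / (2 * pi)) *\<^sub>R (\<Sum>p | p \<noteq> r. (\<Gamma> p / ((hinner (X$p) (X$r))\<^sup>2 - 1)) *\<^sub>R X$p)
            + (l r / \<Gamma> r) *\<^sub>R X$r)"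

definition momentum :: "(3 \<Rightarrow> real) \<Rightarrow> real^3^3 \<Rightarrow> real^3" where
  "momentum \<Gamma> X = \<Gamma> 1 *\<^sub>R X$1 + \<Gamma> 2 *\<^sub>R X$2 + \<Gamma> 3 *\<^sub>R X$3"

end

theory Submission
  imports Defs
begin

text \<open>
  On an equilateral configuration the field is \<open>X\<^sub>r \<mapsto> w \<times> X\<^sub>r\<close> with \<open>w = J / (\<pi> L)\<close>. The linear
  flow of \<open>w \<times> _\<close> is conjugation by a one-parameter subgroup of \<open>SL(2,\<real>)\<close>; it preserves \<open>J\<close>
  and \<open>L\<close>, so it solves the vortex equations for all time. Conversely, along any integral curve
  the three Lorentz products satisfy \<open>a' = \<alpha> (b - c)\<close> and its cyclic permutations with continuous
  coefficients, so by Gronwall the curve stays equilateral; then \<open>L\<close> and \<open>J\<close> are constant and the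
  curve obeys the same linear equation, which has a unique solution. For the angular velocity, the
  multipliers shift \<open>J / (2 \<pi> L)\<close> by a multiple of each \<open>X\<^sub>r\<close>, and distinct points of the
  hyperboloid are linearly independent.
\<close>

section \<open>Uniqueness for linearly bounded derivatives\<close>

text \<open>The function \<open>|w|^2 exp (- 2 B s)\<close> is nonincreasing, since Cauchy-Schwarz
  bounds \<open>w \<bullet> w'\<close> by \<open>B |w|^2\<close>. It starts at zero and is never
  negative.\<close>

lemma gronwall_zero_right:
  fixes w :: "real \<Rightarrow> 'a::real_inner"
  assumes t: "0 \<le> t" and w0: "w 0 = 0"
    and der: "\<And>s. 0 \<le> s \<Longrightarrow> s \<le> t \<Longrightarrow> (w has_vector_derivative w' s) (at s)"
    and bound: "\<And>s. 0 \<le> s \<Longrightarrow> s \<le> t \<Longrightarrow> norm (w' s) \<le> B * norm (w s)"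
  shows "w t = 0"
proof -
  define f where "f s = (w s \<bullet> w s) * exp (- (2 * B * s))" for s
  have "f t \<le> f 0"
  proof (rule DERIV_nonpos_imp_nonincreasing[OF t])
    fix s assume s: "0 \<le> s" "s \<le> t"
    have w: "(w has_derivative (\<lambda>h. h *\<^sub>R w' s)) (at s)"
      using der[OF s] by (simp add: has_vector_derivative_def)
    have inn: "((\<lambda>s. w s \<bullet> w s) has_real_derivative 2 * (w s \<bullet> w' s)) (at s)"
      unfolding has_field_derivative_def
      by (rule has_derivative_eq_rhs[OF has_derivative_inner[OF w w]])
        (simp add: fun_eq_iff inner_commute)
    have "(f has_real_derivative
        (2 * (w s \<bullet> w' s) - 2 * B * (w s \<bullet> w s)) * exp (- (2 * B * s))) (at s)"
      unfolding f_def by (rule derivative_eq_intros inn refl | simp add: algebra_simps)+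
    moreover have "w s \<bullet> w' s \<le> B * (w s \<bullet> w s)"
    proof -
      have "w s \<bullet> w' s \<le> norm (w s) * norm (w' s)"
        by (rule norm_cauchy_schwarz)
      also have "\<dots> \<le> norm (w s) * (B * norm (w s))"
        using bound[OF s] by (intro mult_left_mono) auto
      finally show ?thesis
        by (simp add: dot_square_norm power2_eq_square algebra_simps)
    qed
    ultimately show "\<exists>y. (f has_real_derivative y) (at s) \<and> y \<le> 0"
      by (intro exI[of _ "(2 * (w s \<bullet> w' s) - 2 * B * (w s \<bullet> w s)) * exp (- (2 * B * s))"])
        (auto intro!: mult_nonpos_nonneg)
  qed
  then have "w t \<bullet> w t \<le> 0"
    by (simp add: f_def w0 mult_le_0_iff)
  then show ?thesis
    by (metis inner_eq_zero_iff inner_ge_zero order_antisym)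
qed

text \<open>On the compact segment from 0 to \<open>t\<close> the continuous rate \<open>K\<close>
  is bounded by a constant, which reduces the claim to the one-sided case. Negative times are
  handled by reversing time.\<close>

lemma gronwall_zero:
  fixes w :: "real \<Rightarrow> 'a::real_inner"
  assumes I: "is_interval I" "0 \<in> I" and w0: "w 0 = 0"
    and der: "\<And>s. s \<in> I \<Longrightarrow> (w has_vector_derivative w' s) (at s)"
    and cont: "continuous_on I K"
    and bound: "\<And>s. s \<in> I \<Longrightarrow> norm (w' s) \<le> K s * norm (w s)"
    and t: "t \<in> I"
  shows "w t = 0"
proof -
  have seg: "closed_segment 0 t \<subseteq> I"
    using I t by (meson closed_segment_subset is_interval_convex)
  have "compact (K ` closed_segment 0 t)"
    using continuous_on_subset[OF cont seg] by (intro compact_continuous_image) auto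
  then obtain B where "\<forall>x \<in> K ` closed_segment 0 t. norm x \<le> B"
    using compact_imp_bounded bounded_iff by blast
  then have B: "K s \<le> B" if "s \<in> closed_segment 0 t" for s
    using that by (simp add: abs_le_iff)
  have bd: "norm (w' s) \<le> B * norm (w s)" if "s \<in> closed_segment 0 t" for s
    using bound[of s] B[OF that] that seg
    by (meson mult_right_mono norm_ge_zero order_trans subsetD)
  show ?thesis
  proof (cases "0 \<le> t")
    case True
    then have "s \<in> closed_segment 0 t" if "0 \<le> s" "s \<le> t" for s
      using that by (simp add: closed_segment_eq_real_ivl)
    then show ?thesis
      using gronwall_zero_right[where w = w and w' = w' and B = B and t = t] True w0 der bd seg by blast
  next
    case False
    have mem: "- s \<in> closed_segment 0 t" if "0 \<le> s" "s \<le> - t" for s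
      using that False by (simp add: closed_segment_eq_real_ivl)
    have "((\<lambda>s. w (- s)) has_vector_derivative - w' (- s)) (at s)" if "0 \<le> s" "s \<le> - t" for s
    proof -
      have "(uminus has_vector_derivative - 1) (at s)"
        by (auto intro!: derivative_eq_intros)
      from vector_diff_chain_at[OF this, of w "w' (- s)"] show ?thesis
        using der mem[OF that] seg by (auto simp: o_def)
    qed
    then show ?thesis
      using gronwall_zero_right[of "- t" "\<lambda>s. w (- s)" "\<lambda>s. - w' (- s)" B] bd mem False w0
      by auto
  qed
qed

section \<open>Lorentzian algebra\<close>

lemma hcross_nth [simp]:
  "hcross u v $ 1 = u$2 * v$3 - u$3 * v$2"
  "hcross u v $ 2 = u$3 * v$1 - u$1 * v$3"
  "hcross u v $ 3 = - (u$1 * v$2) + u$2 * v$1"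
  by (simp_all add: hcross_def)

lemma bounded_bilinear_hinner: "bounded_bilinear hinner"
proof (rule bilinear_conv_bounded_bilinear[THEN iffD1])
  show "bilinear hinner"
    by (auto simp: bilinear_def linear_iff hinner_def algebra_simps)
qed

lemma bounded_bilinear_hcross: "bounded_bilinear hcross"
proof (rule bilinear_conv_bounded_bilinear[THEN iffD1])
  show "bilinear hcross"
    by (auto simp: bilinear_def linear_iff vec_eq_iff forall_3 algebra_simps)
qed

interpretation hinner: bounded_bilinear hinner
  by (rule bounded_bilinear_hinner)

interpretation hcross: bounded_bilinear hcross
  by (rule bounded_bilinear_hcross)

lemma hinner_commute: "hinner u v = hinner v u"
  by (simp add: hinner_def)

lemma hcross_self [simp]: "hcross u u = 0"
  by (simp add: vec_eq_iff forall_3)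

lemma hinner_hcross_same [simp]:
  "hinner (hcross u v) u = 0" "hinner (hcross u v) v = 0"
  by (simp_all add: hinner_def algebra_simps)

text \<open>Infinitesimal form of Lorentz invariance: \<open>hcross u\<close> is skew for the
  Lorentz product, so its linear flow preserves that product.\<close>

lemma hinner_hcross_skew: "hinner (hcross u v) w + hinner v (hcross u w) = 0"
  by (simp add: hinner_def algebra_simps)

text \<open>Lorentzian triple product expansion, with sign opposite to the Euclidean one. It makes
  the span of \<open>v\<close>, \<open>hcross w v\<close> and \<open>w\<close> invariant under
  \<open>hcross w\<close>, so the flow has a closed form.\<close>

lemma hcross_hcross: "hcross w (hcross w v) = hinner w w *\<^sub>R v - hinner w v *\<^sub>R w"
  by (simp add: vec_eq_iff forall_3 hinner_def algebra_simps)

lemma hinner_self_hyperbolic: "u \<in> hyperbolic_plane \<Longrightarrow> hinner u u = - 1"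
  by (simp add: hyperbolic_plane_def hinner_def power2_eq_square)

lemma hyperbolic_plane_iff: "u \<in> hyperbolic_plane \<longleftrightarrow> hinner u u = - 1 \<and> u$3 > 0"
  by (auto simp: hyperbolic_plane_def hinner_def power2_eq_square)

lemma hinner_less_minus_one:
  assumes "u \<in> hyperbolic_plane" "v \<in> hyperbolic_plane" "u \<noteq> v"
  shows "hinner u v < - 1"
proof (rule ccontr)
  assume "\<not> hinner u v < - 1"
  then have e: "u$3 * v$3 = u$1 * v$1 + u$2 * v$2 + 1"
    using hinner_le_minus_one[OF assms(1,2)] by (simp add: hinner_def)
  have u: "(u$3)\<^sup>2 = 1 + (u$1)\<^sup>2 + (u$2)\<^sup>2" "u$3 > 0"
    and v: "(v$3)\<^sup>2 = 1 + (v$1)\<^sup>2 + (v$2)\<^sup>2" "v$3 > 0"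
    using assms(1,2) by (auto simp: hyperbolic_plane_def)
  \<comment> \<open>Equality case of the reversed Cauchy-Schwarz inequality: these three squares are
    the gap between \<open>(u$3 * v$3)\<^sup>2\<close> and the square of the right-hand side of
    \<open>e\<close>.\<close>
  have "(u$1 - v$1)\<^sup>2 + (u$2 - v$2)\<^sup>2 + (u$1 * v$2 - u$2 * v$1)\<^sup>2 = 0"
    using e u(1) v(1) by algebra
  then have "u$1 = v$1" "u$2 = v$2"
    by (smt (verit) zero_le_power2 zero_eq_power2)+
  moreover from this have "u$3 = v$3"
    using u v by (metis less_imp_le power2_eq_imp_eq)
  ultimately show False
    using assms(3) by (simp add: vec_eq_iff forall_3)
qed

lemma hyperbolic_sq_pos:
  assumes "X \<in> phase_space" "i \<noteq> j"
  shows "(hinner (X$i) (X$j))\<^sup>2 - 1 > 0"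
proof -
  have "hinner (X$i) (X$j) < - 1"
    using assms by (intro hinner_less_minus_one) (auto simp: phase_space_def)
  then have "1 < (- hinner (X$i) (X$j))\<^sup>2"
    by (intro one_less_power) auto
  then show ?thesis by simp
qed

text \<open>Pairing the relation with \<open>u\<close> and with \<open>v\<close> gives a linear
  system for \<open>c\<close> and \<open>d\<close> whose Gram determinant
  \<open>1 - (hinner u v)\<^sup>2\<close> is nonzero for distinct points.\<close>

lemma hyperbolic_scale_eq_0:
  assumes "u \<in> hyperbolic_plane" "v \<in> hyperbolic_plane" "u \<noteq> v" "c *\<^sub>R u = d *\<^sub>R v"
  shows "c = 0"
proof -
  have "c * hinner u u = d * hinner v u" "c * hinner u v = d * hinner v v"
    using assms(4) by (metis hinner.scaleR_left real_scaleR_def)+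
  then have "c * - 1 = d * hinner u v" "c * hinner u v = d * - 1"
    using assms(1,2) by (simp_all add: hinner_self_hyperbolic hinner_commute)
  then have "c * ((hinner u v)\<^sup>2 - 1) = 0"
    by algebra
  moreover have "(hinner u v)\<^sup>2 \<noteq> 1"
    using hinner_less_minus_one[OF assms(1-3)] by (auto simp: power2_eq_1_iff)
  ultimately show ?thesis by simp
qed

section \<open>Derivatives of Lorentz products and of configurations\<close>

lemma has_vector_derivative_hinner:
  assumes "(f has_vector_derivative f') (at t)" "(g has_vector_derivative g') (at t)"
  shows "((\<lambda>s. hinner (f s) (g s)) has_real_derivative hinner f' (g t) + hinner (f t) g') (at t)"
  using hinner.has_vector_derivative[OF assms]
  by (simp add: has_real_derivative_iff_has_vector_derivative add.commute)

lemma has_vector_derivative_vec: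
  fixes f :: "real \<Rightarrow> 'a::euclidean_space^'n"
  assumes "\<And>i. ((\<lambda>s. f s $ i) has_vector_derivative f' $ i) (at t within S)"
  shows "(f has_vector_derivative f') (at t within S)"
  unfolding has_vector_derivative_def has_derivative_componentwise_within[of f]
proof
  fix b :: "'a^'n"
  assume "b \<in> Basis"
  then obtain i u where b: "b = axis i u"
    by (auto simp: Basis_vec_def)
  have "((\<lambda>s. f s $ i \<bullet> u) has_derivative (\<lambda>h. (h *\<^sub>R f' $ i) \<bullet> u)) (at t within S)"
    using assms[of i] unfolding has_vector_derivative_def by (rule has_derivative_inner_left)
  then show "((\<lambda>s. f s \<bullet> b) has_derivative (\<lambda>h. (h *\<^sub>R f') \<bullet> b)) (at t within S)"
    by (simp add: b inner_axis)
qed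

section \<open>One-parameter subgroups\<close>

text \<open>\<open>C\<close> and \<open>S\<close> are the fundamental solutions of
  \<open>y'' = d y\<close>: polynomial, hyperbolic or trigonometric by the sign of \<open>d\<close>.
  For a matrix \<open>A\<close> with \<open>A^2 = d I\<close>, they give
  \<open>exp (t A) = C t I + S t A\<close>; for traceless 2 by 2 \<open>A\<close>, the last identity
  says that this has determinant one.\<close>

lemma unit_determinant_flow:
  fixes d :: real
  obtains C S :: "real \<Rightarrow> real" where
    "C 0 = 1" "S 0 = 0"
    "\<And>t. (C has_real_derivative d * S t) (at t)"
    "\<And>t. (S has_real_derivative C t) (at t)"
    "\<And>t. (C t)\<^sup>2 - d * (S t)\<^sup>2 = 1"
proof -
  consider "d = 0" | "d > 0" | "d < 0" by linarith
  then show ?thesis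
  proof cases
    case 1
    show ?thesis
      by (rule that[of "\<lambda>_. 1" "\<lambda>t. t"]) (auto simp: 1)
  next
    case 2
    define k where "k = sqrt d"
    have k: "k > 0" "d = k\<^sup>2" using 2 by (simp_all add: k_def)
    show ?thesis
    proof (rule that[of "\<lambda>t. cosh (k * t)" "\<lambda>t. sinh (k * t) / k"])
      fix t
      show "((\<lambda>t. cosh (k * t)) has_real_derivative d * (sinh (k * t) / k)) (at t)"
        using k by (auto intro!: derivative_eq_intros simp: power2_eq_square)
      show "((\<lambda>t. sinh (k * t) / k) has_real_derivative cosh (k * t)) (at t)"
        using k by (auto intro!: derivative_eq_intros)
      show "(cosh (k * t))\<^sup>2 - d * (sinh (k * t) / k)\<^sup>2 = 1"
        using k by (simp add: power_divide cosh_square_eq)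
    qed auto
  next
    case 3
    define k where "k = sqrt (- d)"
    have k: "k > 0" "d = - k\<^sup>2" using 3 by (simp_all add: k_def)
    show ?thesis
    proof (rule that[of "\<lambda>t. cos (k * t)" "\<lambda>t. sin (k * t) / k"])
      fix t
      show "((\<lambda>t. cos (k * t)) has_real_derivative d * (sin (k * t) / k)) (at t)"
        using k by (auto intro!: derivative_eq_intros simp: power2_eq_square)
      show "((\<lambda>t. sin (k * t) / k) has_real_derivative cos (k * t)) (at t)"
        using k by (auto intro!: derivative_eq_intros)
      show "(cos (k * t))\<^sup>2 - d * (sin (k * t) / k)\<^sup>2 = 1"
        using k by (simp add: power_divide)
    qed auto
  qed
qed

text \<open>In matrix form the commutator is \<open>[u, v] = - 2 (u \<times> v)\<close>, hence the generator \<open>- w / 2\<close>;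
  its exponential \<open>C + S (- w / 2)\<close> has inverse \<open>C - S (- w / 2)\<close>. The vector below is the
  conjugate of \<open>v\<close> by this exponential.\<close>
lemma sl2_conjugation:
  fixes w v :: "real^3" and C S :: real
  assumes "C\<^sup>2 - (hinner w w / 4) * S\<^sup>2 = 1"
  defines "g \<equiv> C *\<^sub>R mat 1 + S *\<^sub>R sl2_mat ((- 1 / 2) *\<^sub>R w)"
  shows "det g = 1"
    and "sl2_mat ((C\<^sup>2 + (hinner w w / 4) * S\<^sup>2) *\<^sub>R v + (C * S) *\<^sub>R hcross w v
           - (S\<^sup>2 / 2 * hinner w v) *\<^sub>R w) = g ** sl2_mat v ** matrix_inv g"
proof -
  define h where "h = C *\<^sub>R mat 1 - S *\<^sub>R sl2_mat ((- 1 / 2) *\<^sub>R w)"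
  note defs = g_def h_def sl2_mat_def mat_def
  \<comment> \<open>The determinant condition without denominators; it is the only relation between
    \<open>C\<close>, \<open>S\<close> and \<open>w\<close> that the matrix identities need.\<close>
  have e: "4 * C\<^sup>2 = 4 + ((w$1)\<^sup>2 + (w$2)\<^sup>2 - (w$3)\<^sup>2) * S\<^sup>2"
    using assms(1) by (simp add: hinner_def power2_eq_square)
  have gh: "g ** h = mat 1" and hg: "h ** g = mat 1"
    unfolding vec_eq_iff forall_2 matrix_matrix_mult_def
    using e by (auto simp: defs sum_2 field_simps power2_eq_square)
  have inv: "matrix_inv g = h"
  proof -
    \<comment> \<open>\<open>matrix_inv\<close> is a choice of two-sided inverse. The witness
      \<open>h\<close> shows that one exists, and uniqueness of inverses then identifies the choice
      with \<open>h\<close>.\<close>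
    have "g ** matrix_inv g = mat 1 \<and> matrix_inv g ** g = mat 1"
      unfolding matrix_inv_def by (rule someI[of _ h]) (simp add: gh hg)
    then show ?thesis
      using hg by (metis matrix_mul_assoc matrix_mul_lid matrix_mul_rid)
  qed
  show "det g = 1"
    using e by (simp add: det_2 defs field_simps power2_eq_square)
  show "sl2_mat ((C\<^sup>2 + (hinner w w / 4) * S\<^sup>2) *\<^sub>R v + (C * S) *\<^sub>R hcross w v
           - (S\<^sup>2 / 2 * hinner w v) *\<^sub>R w) = g ** sl2_mat v ** matrix_inv g"
  proof -
    \<comment> \<open>Writing \<open>w = - 2 (p, q, r)\<close> gives the generator the plain entries
      \<open>p\<close>, \<open>q + r\<close>, \<open>q - r\<close>, \<open>- p\<close>, and the
      claim becomes a polynomial identity.\<close>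
    obtain p q r where w: "w$1 = - 2 * p" "w$2 = - 2 * q" "w$3 = - 2 * r"
      by (metis mult_minus_left mult_2 field_sum_of_halves minus_minus)
    have scalars: "hinner w w / 4 = p * p + q * q - r * r"
      "S\<^sup>2 / 2 * hinner w v = - (S * S) * (p * v$1 + q * v$2 - r * v$3)"
      by (simp_all add: hinner_def w power2_eq_square field_simps)
    show ?thesis
      unfolding inv vec_eq_iff forall_2 matrix_matrix_mult_def scalars
      by (simp add: defs sum_2 w) (simp add: algebra_simps power2_eq_square)
  qed
qed

text \<open>The conjugating matrix depends on \<open>t\<close> but not on \<open>v\<close>, so one
  \<open>g\<close> moves all three vortices at once, as the diagonal action requires.\<close>

lemma sl2_flow:
  fixes w :: "real^3"
  obtains R :: "real \<Rightarrow> real^3 \<Rightarrow> real^3" where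
    "\<And>v. R 0 v = v"
    "\<And>t v. ((\<lambda>t. R t v) has_vector_derivative hcross w (R t v)) (at t)"
    "\<And>t. \<exists>g :: real^2^2. det g = 1 \<and> (\<forall>v. sl2_mat (R t v) = g ** sl2_mat v ** matrix_inv g)"
proof -
  obtain C S :: "real \<Rightarrow> real" where CS: "C 0 = 1" "S 0 = 0"
    "\<And>t. (C has_real_derivative (hinner w w / 4) * S t) (at t)"
    "\<And>t. (S has_real_derivative C t) (at t)"
    "\<And>t. (C t)\<^sup>2 - (hinner w w / 4) * (S t)\<^sup>2 = 1"
    using unit_determinant_flow[of "hinner w w / 4"] by metis
  define R where "R t v = ((C t)\<^sup>2 + (hinner w w / 4) * (S t)\<^sup>2) *\<^sub>R v + (C t * S t) *\<^sub>R hcross w v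
           - ((S t)\<^sup>2 / 2 * hinner w v) *\<^sub>R w" for t v
  show ?thesis
  proof (rule that)
    show "R 0 v = v" for v
      by (simp add: R_def CS)
    show "((\<lambda>t. R t v) has_vector_derivative hcross w (R t v)) (at t)" for t v
    proof -
      have 1: "((\<lambda>t. (C t)\<^sup>2 + (hinner w w / 4) * (S t)\<^sup>2) has_real_derivative
          hinner w w * C t * S t) (at t)"
        by (rule derivative_eq_intros CS refl | simp)+
      have 2: "((\<lambda>t. C t * S t) has_real_derivative (C t)\<^sup>2 + (hinner w w / 4) * (S t)\<^sup>2) (at t)"
        by (rule derivative_eq_intros CS refl | simp add: power2_eq_square)+
      have 3: "((\<lambda>t. (S t)\<^sup>2 / 2 * hinner w v) has_real_derivative C t * S t * hinner w v) (at t)"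
        by (rule derivative_eq_intros CS refl | simp)+
      have "((\<lambda>t. R t v) has_vector_derivative
          (hinner w w * C t * S t) *\<^sub>R v + ((C t)\<^sup>2 + (hinner w w / 4) * (S t)\<^sup>2) *\<^sub>R hcross w v
          - (C t * S t * hinner w v) *\<^sub>R w) (at t)"
        unfolding R_def
        by (rule derivative_eq_intros 1 2 3 refl | simp)+
      \<comment> \<open>The triple product expansion turns the middle term of \<open>R t v\<close>
        into the first and last terms here, while \<open>hcross w w = 0\<close> removes its last
        term.\<close>
      also have "(hinner w w * C t * S t) *\<^sub>R v + ((C t)\<^sup>2 + (hinner w w / 4) * (S t)\<^sup>2) *\<^sub>R hcross w v
          - (C t * S t * hinner w v) *\<^sub>R w = hcross w (R t v)"
        by (simp add: R_def hcross.add_right hcross.diff_right hcross.scaleR_right hcross_hcross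
            algebra_simps)
      finally show ?thesis .
    qed
    show "\<exists>g :: real^2^2. det g = 1 \<and> (\<forall>v. sl2_mat (R t v) = g ** sl2_mat v ** matrix_inv g)" for t
      unfolding R_def using sl2_conjugation[OF CS(5)[of t]] by blast
  qed
qed

section \<open>Invariants of the linear flow\<close>

lemma hcross_flow_hinner_constant:
  assumes "\<And>t. (f has_vector_derivative hcross w (f t)) (at t)"
    and "\<And>t. (g has_vector_derivative hcross w (g t)) (at t)"
  shows "hinner (f t) (g t) = hinner (f 0) (g 0)"
proof -
  have "((\<lambda>s. hinner (f s) (g s)) has_real_derivative 0) (at t)" for t
    using has_vector_derivative_hinner[OF assms(1)[of t] assms(2)[of t]]
    by (simp add: hinner_hcross_skew)
  then show ?thesis
    using DERIV_isconst_all[of "\<lambda>s. hinner (f s) (g s)" t 0] by blast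
qed

text \<open>The flow preserves the two-sheeted quadric \<open>hinner u u = - 1\<close>. The third
  coordinate never vanishes there, so by continuity the curve cannot leave the upper sheet.\<close>

lemma hcross_flow_hyperbolic_plane:
  assumes "\<And>t. (f has_vector_derivative hcross w (f t)) (at t)" "f 0 \<in> hyperbolic_plane"
  shows "f t \<in> hyperbolic_plane"
proof -
  have h: "hinner (f s) (f s) = - 1" for s
    using hcross_flow_hinner_constant[OF assms(1,1)] assms(2) by (simp add: hinner_self_hyperbolic)
  have nz: "f s $ 3 \<noteq> 0" for s
    using h[of s] by (auto simp: hinner_def) (smt (verit) not_square_less_zero)
  have cont: "continuous_on UNIV (\<lambda>s. f s $ 3)"
    using assms(1) by (intro continuous_on_component continuous_at_imp_continuous_on ballI)
      (auto intro: has_vector_derivative_continuous)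
  have "f t $ 3 > 0"
  proof (rule ccontr)
    assume "\<not> f t $ 3 > 0"
    moreover have "f 0 $ 3 > 0" using assms(2) by (simp add: hyperbolic_plane_def)
    moreover have "connected (range (\<lambda>s. f s $ 3))"
      using cont by (intro connected_continuous_image) auto
    ultimately have "0 \<in> range (\<lambda>s. f s $ 3)"
      by (meson connectedD_interval less_imp_le not_less rangeI)
    then show False using nz by force
  qed
  with h show ?thesis by (simp add: hyperbolic_plane_iff)
qed

section \<open>Equilateral configurations\<close>

lemma equilateral_iff_hinner:
  assumes "X \<in> phase_space"
  shows "equilateral X \<longleftrightarrow>
    hinner (X$1) (X$2) = hinner (X$2) (X$3) \<and> hinner (X$2) (X$3) = hinner (X$3) (X$1)"
proof -
  have "hinner (X$i) (X$j) = - cosh (hdist (X$i) (X$j))" for i j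
    using assms by (intro hinner_eq_cosh_hdist) (auto simp: phase_space_def)
  then show ?thesis
    unfolding equilateral_def by (metis hdist_def)
qed

lemma equilateral_hinner_eq:
  assumes "X \<in> phase_space" "equilateral X" "i \<noteq> j"
  shows "hinner (X$i) (X$j) = hinner (X$1) (X$2)"
  using assms exhaust_3[of i] exhaust_3[of j]
  by (auto simp: equilateral_iff_hinner hinner_commute)

lemma sum_others:
  fixes f :: "3 \<Rightarrow> 'a::ab_group_add"
  shows "(\<Sum>p | p \<noteq> r. f p) = f 1 + f 2 + f 3 - f r"
proof -
  have "{p. p \<noteq> r} = UNIV - {r}" by auto
  then show ?thesis by (simp add: sum_diff1 sum_3)
qed

text \<open>With equal denominators only the self-term separates the sum from a multiple of the
  momentum. In the vortex field this term is killed by the cross product; in the angular velocity it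
  is absorbed by the multiplier.\<close>

lemma weighted_sum_others:
  assumes "\<And>p. p \<noteq> r \<Longrightarrow> c p = L"
  shows "(\<Sum>p | p \<noteq> r. (\<Gamma> p / c p) *\<^sub>R X$p) = (1 / L) *\<^sub>R (momentum \<Gamma> X - \<Gamma> r *\<^sub>R X$r)"
proof -
  have "(\<Sum>p | p \<noteq> r. (\<Gamma> p / c p) *\<^sub>R X$p) = (\<Sum>p | p \<noteq> r. (1 / L) *\<^sub>R (\<Gamma> p *\<^sub>R X$p))"
    by (rule sum.cong) (auto simp: assms)
  also have "\<dots> = (1 / L) *\<^sub>R (\<Sum>p | p \<noteq> r. \<Gamma> p *\<^sub>R X$p)"
    by (simp only: scaleR_sum_right)
  finally show ?thesis
    by (simp add: sum_others momentum_def)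
qed

lemma vortex_field_nth:
  "vortex_field \<Gamma> X $ r = (1 / pi) *\<^sub>R
     hcross (\<Sum>p | p \<noteq> r. (\<Gamma> p / ((hinner (X$r) (X$p))\<^sup>2 - 1)) *\<^sub>R X$p) (X$r)"
  by (simp add: vortex_field_def hcross.sum_left hcross.scaleR_left)

lemma vortex_field_equilateral:
  assumes "\<And>i j. i \<noteq> j \<Longrightarrow> (hinner (X$i) (X$j))\<^sup>2 - 1 = L"
  shows "vortex_field \<Gamma> X $ r = hcross ((1 / (pi * L)) *\<^sub>R momentum \<Gamma> X) (X$r)"
  by (subst vortex_field_nth, subst weighted_sum_others[where L = L])
    (auto simp: assms hcross.scaleR_left hcross.diff_left)

text \<open>Only the third vortex changes the distance of the other two, and the factor
  \<open>hinner (X$j) (X$k) - hinner (X$k) (X$i)\<close> makes equilaterality invariant by Gronwall.\<close>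
lemma vortex_field_hinner:
  assumes "X \<in> phase_space" "i \<noteq> j" "j \<noteq> k" "k \<noteq> i"
  shows "hinner (vortex_field \<Gamma> X $ i) (X$j) + hinner (X$i) (vortex_field \<Gamma> X $ j) =
    \<Gamma> k / pi * hinner (hcross (X$k) (X$i)) (X$j) * (hinner (X$j) (X$k) + hinner (X$k) (X$i))
      / (((hinner (X$k) (X$i))\<^sup>2 - 1) * ((hinner (X$j) (X$k))\<^sup>2 - 1))
    * (hinner (X$j) (X$k) - hinner (X$k) (X$i))"
proof -
  have others: "{p. p \<noteq> i} = {j, k}" "{p. p \<noteq> j} = {i, k}"
  proof -
    have "\<forall>i j k p :: 3. i \<noteq> j \<longrightarrow> j \<noteq> k \<longrightarrow> k \<noteq> i \<longrightarrow> p = i \<or> p = j \<or> p = k"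
      by (simp add: forall_3)
    then show "{p. p \<noteq> i} = {j, k}" "{p. p \<noteq> j} = {i, k}"
      using assms(2-4) by blast+
  qed
  define b c T where "b = hinner (X$j) (X$k)" and "c = hinner (X$k) (X$i)"
    and "T = hinner (hcross (X$k) (X$i)) (X$j)"
  have nz: "b\<^sup>2 - 1 \<noteq> 0" "c\<^sup>2 - 1 \<noteq> 0"
    using hyperbolic_sq_pos[OF assms(1)] assms(3,4) by (auto simp: b_def c_def less_le)
  have T: "hinner (X$i) (hcross (X$k) (X$j)) = - T"
    using hinner_hcross_skew[of "X$k" "X$i" "X$j"] by (simp add: T_def)
  have "hinner (vortex_field \<Gamma> X $ i) (X$j) = (\<Gamma> k / pi) * T / (c\<^sup>2 - 1)"
    using assms(2-4)
    by (simp add: vortex_field_def others hinner.add_left hinner.scaleR_left T_def c_def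
        hinner_commute[of "X$i" "X$k"])
  moreover have "hinner (X$i) (vortex_field \<Gamma> X $ j) = - (\<Gamma> k / pi) * T / (b\<^sup>2 - 1)"
    using assms(2-4)
    by (simp add: vortex_field_def others hinner.add_right hinner.scaleR_right T b_def
        hinner_commute[of "X$i" "hcross (X$i) (X$j)"])
  moreover have "(\<Gamma> k / pi) * T / (c\<^sup>2 - 1) + - (\<Gamma> k / pi) * T / (b\<^sup>2 - 1)
      = \<Gamma> k / pi * T * (b + c) / ((c\<^sup>2 - 1) * (b\<^sup>2 - 1)) * (b - c)"
  proof -
    have frac: "m / z - m / y = m * (y - z) / (z * y)" if "y \<noteq> 0" "z \<noteq> 0" for m y z :: real
      using that by (simp add: field_simps)
    have "(\<Gamma> k / pi) * T / (c\<^sup>2 - 1) + - (\<Gamma> k / pi) * T / (b\<^sup>2 - 1)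
      = (\<Gamma> k / pi) * T * ((b\<^sup>2 - 1) - (c\<^sup>2 - 1)) / ((c\<^sup>2 - 1) * (b\<^sup>2 - 1))"
      using frac[OF nz, of "(\<Gamma> k / pi) * T"] by simp
    also have "(b\<^sup>2 - 1) - (c\<^sup>2 - 1) = (b + c) * (b - c)"
      by (simp add: power2_eq_square algebra_simps)
    finally show ?thesis by (simp add: mult.assoc)
  qed
  ultimately show ?thesis
    by (simp only: b_def c_def T_def)
qed

section \<open>Equilaterality and momentum along arbitrary integral curves\<close>

text \<open>The vector of the three differences satisfies a linear differential inequality and
  vanishes at time zero, so Gronwall keeps it zero. Then the derivative of \<open>a\<close> vanishes
  as well.\<close>

lemma cyclic_differences_vanish:
  fixes a b c \<alpha> \<beta> \<gamma> :: "real \<Rightarrow> real"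
  assumes I: "is_interval I" "0 \<in> I"
    and a: "\<And>t. t \<in> I \<Longrightarrow> (a has_real_derivative \<alpha> t * (b t - c t)) (at t)"
    and b: "\<And>t. t \<in> I \<Longrightarrow> (b has_real_derivative \<beta> t * (c t - a t)) (at t)"
    and c: "\<And>t. t \<in> I \<Longrightarrow> (c has_real_derivative \<gamma> t * (a t - b t)) (at t)"
    and cont: "continuous_on I \<alpha>" "continuous_on I \<beta>" "continuous_on I \<gamma>"
    and init: "a 0 = b 0" "b 0 = c 0"
    and t: "t \<in> I"
  shows "a t = b t \<and> b t = c t \<and> a t = a 0"
proof -
  define w where "w s = (a s - b s, b s - c s, c s - a s)" for s
  define w' where "w' s = (\<alpha> s * (b s - c s) - \<beta> s * (c s - a s),
    \<beta> s * (c s - a s) - \<gamma> s * (a s - b s), \<gamma> s * (a s - b s) - \<alpha> s * (b s - c s))" for s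
  \<comment> \<open>Each of the three derivatives enters two components of \<open>w'\<close>, hence
    the factor 2.\<close>
  define K where "K s = 2 * (\<bar>\<alpha> s\<bar> + \<bar>\<beta> s\<bar> + \<bar>\<gamma> s\<bar>)" for s
  have w: "w s = 0" if s: "s \<in> I" for s
  proof (rule gronwall_zero[OF I _ _ _ _ s, of w w' K])
    show "w 0 = 0" by (simp add: w_def init zero_prod_def)
    show "continuous_on I K"
      unfolding K_def by (intro continuous_intros cont)
    fix s assume s: "s \<in> I"
    show "(w has_vector_derivative w' s) (at s)"
      unfolding w_def w'_def
      by (intro has_vector_derivative_Pair)
        (auto intro!: derivative_eq_intros a[OF s] b[OF s] c[OF s]
          simp flip: has_real_derivative_iff_has_vector_derivative)
    have n: "\<bar>a s - b s\<bar> \<le> norm (w s)" "\<bar>b s - c s\<bar> \<le> norm (w s)" "\<bar>c s - a s\<bar> \<le> norm (w s)"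
      using norm_fst_le[of "a s - b s" "(b s - c s, c s - a s)"]
        norm_snd_le[of "(b s - c s, c s - a s)" "a s - b s"]
        norm_fst_le[of "b s - c s" "c s - a s"] norm_snd_le[of "c s - a s" "b s - c s"]
      by (auto simp: w_def)
    have ab: "\<bar>\<alpha> s * (b s - c s)\<bar> \<le> \<bar>\<alpha> s\<bar> * norm (w s)" "\<bar>\<beta> s * (c s - a s)\<bar> \<le> \<bar>\<beta> s\<bar> * norm (w s)"
      "\<bar>\<gamma> s * (a s - b s)\<bar> \<le> \<bar>\<gamma> s\<bar> * norm (w s)"
      using n by (auto simp: abs_mult intro!: mult_left_mono)
    have tri: "norm (x, y, z) \<le> \<bar>x\<bar> + (\<bar>y\<bar> + \<bar>z\<bar>)" for x y z :: real
      using norm_Pair_le[of x "(y, z)"] norm_Pair_le[of y z] by simp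
    have pairs: "\<bar>x - y\<bar> + (\<bar>y - z\<bar> + \<bar>z - x\<bar>) \<le> 2 * (\<bar>x\<bar> + \<bar>y\<bar> + \<bar>z\<bar>)" for x y z :: real
      by (smt (verit))
    have "norm (w' s) \<le> 2 * (\<bar>\<alpha> s\<bar> * norm (w s) + \<bar>\<beta> s\<bar> * norm (w s) + \<bar>\<gamma> s\<bar> * norm (w s))"
      unfolding w'_def
      by (rule order_trans[OF tri], rule order_trans[OF pairs]) (intro mult_left_mono add_mono ab; simp)
    then show "norm (w' s) \<le> K s * norm (w s)"
      by (simp add: K_def algebra_simps)
  qed
  have eq: "a s = b s" "b s = c s" if "s \<in> I" for s
  proof -
    have "a s - b s = 0" "b s - c s = 0"
      using w[OF that] unfolding w_def zero_prod_def by blast+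
    then show "a s = b s" "b s = c s" by simp_all
  qed
  have "(a has_real_derivative 0) (at s within I)" if "s \<in> I" for s
    using has_field_derivative_at_within[OF a[OF that]] eq[OF that] by simp
  then obtain k where "\<And>s. s \<in> I \<Longrightarrow> a s = k"
    using has_field_derivative_zero_constant[OF is_interval_convex[OF I(1)]] by metis
  then show ?thesis
    using eq[OF t] I t by simp
qed

text \<open>This concerns every integral curve, not just the explicit one, as maximality of the
  trajectory demands a comparison with all competitors.\<close>

lemma integral_curve_hinner_constant:
  assumes curve: "integral_curve \<Gamma> X I \<psi>" and eq: "equilateral X" and t: "t \<in> I" and ij: "i \<noteq> j"
  shows "hinner (\<psi> t $ i) (\<psi> t $ j) = hinner (X$1) (X$2)"
proof -
  have I: "is_interval I" "0 \<in> I" and \<psi>0: "\<psi> 0 = X"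
    and ph: "\<And>s. s \<in> I \<Longrightarrow> \<psi> s \<in> phase_space"
    and der: "\<And>s. s \<in> I \<Longrightarrow> (\<psi> has_vector_derivative vortex_field \<Gamma> (\<psi> s)) (at s)"
    using curve by (auto simp: integral_curve_def)
  have X: "X \<in> phase_space" using ph[OF I(2)] \<psi>0 by simp
  have cont: "continuous_on I (\<lambda>s. \<psi> s $ k)" for k
    using der by (intro continuous_on_component continuous_at_imp_continuous_on ballI)
      (auto intro: has_vector_derivative_continuous)
  define h where "h i j s = hinner (\<psi> s $ i) (\<psi> s $ j)" for i j s
  define q where "q i j k s = \<Gamma> k / pi * hinner (hcross (\<psi> s $ k) (\<psi> s $ i)) (\<psi> s $ j)
      * (h j k s + h k i s) / (((h k i s)\<^sup>2 - 1) * ((h j k s)\<^sup>2 - 1))" for i j k s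
  have hq: "(h i j has_real_derivative q i j k s * (h j k s - h k i s)) (at s)"
    if "s \<in> I" "i \<noteq> j" "j \<noteq> k" "k \<noteq> i" for i j k s
  proof -
    have "((\<lambda>s. \<psi> s $ l) has_vector_derivative vortex_field \<Gamma> (\<psi> s) $ l) (at s)" for l
      using bounded_linear.has_vector_derivative[OF bounded_linear_vec_nth der[OF that(1)]] .
    from has_vector_derivative_hinner[OF this this, of i j] show ?thesis
      unfolding vortex_field_hinner[OF ph[OF that(1)] that(2-4)] h_def q_def .
  qed
  \<comment> \<open>The denominators stay positive because the curve stays in the phase
    space.\<close>
  have qcont: "continuous_on I (q i j k)" if "i \<noteq> j" "j \<noteq> k" "k \<noteq> i" for i j k
  proof -
    have "(h k i s)\<^sup>2 - 1 \<noteq> 0" "(h j k s)\<^sup>2 - 1 \<noteq> 0" if "s \<in> I" for s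
      using hyperbolic_sq_pos[OF ph[OF that], of k i] hyperbolic_sq_pos[OF ph[OF that], of j k]
        \<open>j \<noteq> k\<close> \<open>k \<noteq> i\<close> by (auto simp: h_def)
    moreover have "continuous_on I (h i j)" for i j
      unfolding h_def by (intro hinner.continuous_on cont)
    moreover have "continuous_on I (\<lambda>s. hinner (hcross (\<psi> s $ k) (\<psi> s $ i)) (\<psi> s $ j))"
      by (intro hinner.continuous_on hcross.continuous_on cont)
    ultimately show ?thesis
      unfolding q_def
      by (intro continuous_on_mult continuous_on_divide continuous_on_add continuous_on_diff
          continuous_on_power continuous_on_const) auto
  qed
  have "h 1 2 t = h 2 3 t \<and> h 2 3 t = h 3 1 t \<and> h 1 2 t = h 1 2 0"
    using eq X t
    by (intro cyclic_differences_vanish[OF I hq hq hq qcont qcont qcont])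
      (auto simp: h_def \<psi>0 equilateral_iff_hinner)
  then have "equilateral (\<psi> t)" "h 1 2 t = hinner (X$1) (X$2)"
    using ph[OF t] by (auto simp: equilateral_iff_hinner h_def \<psi>0)
  then show ?thesis
    using equilateral_hinner_eq[OF ph[OF t] _ ij] by (simp add: h_def)
qed

lemma momentum_hcross:
  "momentum \<Gamma> (\<chi> r. hcross w (X$r)) = hcross w (momentum \<Gamma> X)"
  by (simp add: momentum_def hcross.add_right hcross.scaleR_right)

lemma bounded_linear_momentum: "bounded_linear (momentum \<Gamma>)"
  unfolding momentum_def by (intro bounded_linear_intros bounded_linear_vec_nth)

lemma integral_curve_equilateral:
  assumes curve: "integral_curve \<Gamma> X I \<psi>" and eq: "equilateral X" and t: "t \<in> I"
  defines "L \<equiv> (hinner (X$1) (X$2))\<^sup>2 - 1"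
  shows "((\<lambda>s. \<psi> s $ r) has_vector_derivative
    hcross ((1 / (pi * L)) *\<^sub>R momentum \<Gamma> X) (\<psi> t $ r)) (at t)"
proof -
  have I: "is_interval I" "0 \<in> I" and \<psi>0: "\<psi> 0 = X"
    and der: "\<And>s. s \<in> I \<Longrightarrow> (\<psi> has_vector_derivative vortex_field \<Gamma> (\<psi> s)) (at s)"
    using curve by (auto simp: integral_curve_def)
  have field: "vortex_field \<Gamma> (\<psi> s) $ r = hcross ((1 / (pi * L)) *\<^sub>R momentum \<Gamma> (\<psi> s)) (\<psi> s $ r)"
    if "s \<in> I" for s r
    by (rule vortex_field_equilateral) (simp add: integral_curve_hinner_constant[OF curve eq that] L_def)
  \<comment> \<open>The momentum moves by a multiple of \<open>hcross J J = 0\<close>, where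
    \<open>J\<close> is its current value; it is therefore conserved and the equation has constant
    coefficients.\<close>
  have "momentum \<Gamma> (vortex_field \<Gamma> (\<psi> s)) = 0" if "s \<in> I" for s
  proof -
    have "vortex_field \<Gamma> (\<psi> s) = (\<chi> r. hcross ((1 / (pi * L)) *\<^sub>R momentum \<Gamma> (\<psi> s)) (\<psi> s $ r))"
      using field[OF that] by (simp add: vec_eq_iff)
    then show ?thesis
      by (simp only: momentum_hcross) (simp add: hcross.scaleR_left)
  qed
  then have "((\<lambda>s. momentum \<Gamma> (\<psi> s)) has_vector_derivative 0) (at s within I)" if "s \<in> I" for s
    using bounded_linear.has_vector_derivative[OF bounded_linear_momentum der[OF that]] that
    by (metis has_vector_derivative_at_within)
  then obtain k where "\<And>s. s \<in> I \<Longrightarrow> momentum \<Gamma> (\<psi> s) = k"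
    using has_vector_derivative_zero_constant[of I] I by (metis is_interval_convex)
  then have "momentum \<Gamma> (\<psi> t) = momentum \<Gamma> X"
    using t I \<psi>0 by metis
  then show ?thesis
    using bounded_linear.has_vector_derivative[OF bounded_linear_vec_nth der[OF t], of r] field[OF t, of r]
    by simp
qed

section \<open>The equilateral trajectory and its maximality\<close>

text \<open>The difference of two solutions solves the same linear equation, and boundedness of
  \<open>hcross w\<close> supplies a constant Gronwall rate.\<close>

lemma hcross_flow_unique:
  assumes I: "is_interval I" "0 \<in> I" and "f 0 = g 0"
    and f: "\<And>t. t \<in> I \<Longrightarrow> (f has_vector_derivative hcross w (f t)) (at t)"
    and g: "\<And>t. t \<in> I \<Longrightarrow> (g has_vector_derivative hcross w (g t)) (at t)"
    and t: "t \<in> I"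
  shows "f t = g t"
proof -
  obtain B where B: "\<And>v. norm (hcross w v) \<le> B * norm v"
    using bounded_linear.bounded[OF hcross.bounded_linear_right] by (metis mult.commute)
  have "f t - g t = 0"
  proof (rule gronwall_zero[OF I _ _ _ _ t, of "\<lambda>t. f t - g t" "\<lambda>t. hcross w (f t - g t)" "\<lambda>_. B"])
    show "((\<lambda>t. f t - g t) has_vector_derivative hcross w (f s - g s)) (at s)" if "s \<in> I" for s
      using has_vector_derivative_diff[OF f[OF that] g[OF that]] by (simp only: hcross.diff_right)
  qed (simp_all add: assms(3) B)
  then show ?thesis by simp
qed

lemma equilateral_relative_equilibrium:
  assumes X: "X \<in> phase_space" and eq: "equilateral X"
  shows "relative_equilibrium \<Gamma> X"
proof -
  define L where "L = (hinner (X$1) (X$2))\<^sup>2 - 1"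
  \<comment> \<open>This is twice the angular velocity, in accordance with the generator
    \<open>- w / 2\<close> of the conjugation.\<close>
  define w where "w = (1 / (pi * L)) *\<^sub>R momentum \<Gamma> X"
  obtain R :: "real \<Rightarrow> real^3 \<Rightarrow> real^3" where R: "\<And>v. R 0 v = v"
    "\<And>t v. ((\<lambda>t. R t v) has_vector_derivative hcross w (R t v)) (at t)"
    "\<And>t. \<exists>g :: real^2^2. det g = 1 \<and> (\<forall>v. sl2_mat (R t v) = g ** sl2_mat v ** matrix_inv g)"
    by (rule sl2_flow[of w]) (rule that, assumption+)
  define \<phi> where "\<phi> t = (\<chi> r. R t (X$r))" for t
  have Xr: "X$r \<in> hyperbolic_plane" for r
    using X by (simp add: phase_space_def)
  have \<phi>0: "\<phi> 0 = X"
    by (simp add: \<phi>_def R(1) vec_eq_iff)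
  have hin: "hinner (\<phi> t $ i) (\<phi> t $ j) = hinner (X$i) (X$j)" for t i j
    using hcross_flow_hinner_constant[where f = "\<lambda>t. R t (X$i)" and g = "\<lambda>t. R t (X$j)", OF R(2) R(2)]
    by (simp add: \<phi>_def R(1))
  have hyp: "\<phi> t $ r \<in> hyperbolic_plane" for t r
    using hcross_flow_hyperbolic_plane[where f = "\<lambda>t. R t (X$r)", OF R(2)] Xr by (simp add: \<phi>_def R(1))
  have phase: "\<phi> t \<in> phase_space" for t
  proof -
    \<comment> \<open>A collision would force the conserved product of the two points to equal
      \<open>- 1\<close>, its value on coinciding points.\<close>
    have "\<phi> t $ i \<noteq> \<phi> t $ j" if "i \<noteq> j" for i j
    proof
      assume "\<phi> t $ i = \<phi> t $ j"
      then have "hinner (X$i) (X$j) = - 1"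
        using hin[of t i j] hinner_self_hyperbolic[OF hyp[of t j]] by simp
      then show False
        using hyperbolic_sq_pos[OF X that] by simp
    qed
    then show ?thesis using hyp by (simp add: phase_space_def)
  qed
  have mom: "momentum \<Gamma> (\<phi> t) = momentum \<Gamma> X" for t
  proof -
    have "((\<lambda>t. momentum \<Gamma> (\<phi> t)) has_vector_derivative hcross w (momentum \<Gamma> (\<phi> t))) (at t)" for t
      unfolding \<phi>_def momentum_def
      by (auto intro!: derivative_eq_intros R(2) simp: hcross.add_right hcross.scaleR_right)
    \<comment> \<open>Since \<open>w\<close> is parallel to the initial momentum, the constant curve
      solves the same linear equation as the momentum along \<phi>; uniqueness makes them
      equal.\<close>
    moreover have "((\<lambda>_. momentum \<Gamma> X) has_vector_derivative hcross w (momentum \<Gamma> X)) (at t)" for t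
      by (simp add: w_def hcross.scaleR_left)
    ultimately show ?thesis
      using hcross_flow_unique[of UNIV "\<lambda>t. momentum \<Gamma> (\<phi> t)" "\<lambda>_. momentum \<Gamma> X" w t]
      by (simp add: \<phi>0)
  qed
  have field: "vortex_field \<Gamma> (\<phi> t) $ r = hcross w (\<phi> t $ r)" for t r
  proof -
    have "(hinner (\<phi> t $ i) (\<phi> t $ j))\<^sup>2 - 1 = L" if "i \<noteq> j" for i j
      by (simp add: hin L_def equilateral_hinner_eq[OF X eq that])
    from vortex_field_equilateral[OF this] show ?thesis
      by (simp add: w_def mom)
  qed
  have curve: "integral_curve \<Gamma> X UNIV \<phi>"
    unfolding integral_curve_def
  proof (intro conjI ballI phase)
    show "\<phi> 0 = X" by (rule \<phi>0)
    show "(\<phi> has_vector_derivative vortex_field \<Gamma> (\<phi> t)) (at t)" for t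
    proof -
      have "((\<lambda>s. \<phi> s $ r) has_vector_derivative vortex_field \<Gamma> (\<phi> t) $ r) (at t)" for r
        using R(2)[of "X$r" t] by (simp add: field) (simp add: \<phi>_def)
      then show ?thesis
        by (rule has_vector_derivative_vec)
    qed
  qed auto
  \<comment> \<open>Any competing curve obeys the same linear equation in each component, so it
    agrees with \<phi>. As \<phi> exists for all time, this is maximality.\<close>
  have "\<psi> t = \<phi> t" if \<psi>: "integral_curve \<Gamma> X J \<psi>" and t: "t \<in> J" for J \<psi> t
  proof -
    have J: "is_interval J" "0 \<in> J" and "\<psi> 0 = X"
      using \<psi> by (auto simp: integral_curve_def)
    have "\<psi> t $ r = R t (X$r)" for r
    proof (rule hcross_flow_unique[OF J _ _ R(2) t])
      show "((\<lambda>s. \<psi> s $ r) has_vector_derivative hcross w (\<psi> s $ r)) (at s)" if "s \<in> J" for s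
        using integral_curve_equilateral[OF \<psi> eq that, of r] by (simp add: w_def L_def)
    qed (simp add: R(1) \<open>\<psi> 0 = X\<close>)
    then show ?thesis by (simp add: \<phi>_def vec_eq_iff)
  qed
  then have "maximal_integral_curve \<Gamma> X UNIV \<phi>"
    using curve by (auto simp: maximal_integral_curve_def)
  moreover have "range \<phi> \<subseteq> sl2_orbit X"
    using R(3) by (fastforce simp: sl2_orbit_def \<phi>_def)
  ultimately show ?thesis
    using X by (auto simp: relative_equilibrium_def)
qed

section \<open>Angular velocity and Lagrange multipliers\<close>

lemma equilateral_angular_velocity:
  assumes \<Gamma>: "\<forall>r. \<Gamma> r \<noteq> 0" and X: "X \<in> phase_space"
    and L: "\<And>i j. i \<noteq> j \<Longrightarrow> (hinner (X$i) (X$j))\<^sup>2 - 1 = L"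
  shows "is_angular_velocity \<Gamma> X \<xi> \<longleftrightarrow> \<xi> = (1 / (2 * pi * L)) *\<^sub>R momentum \<Gamma> X"
proof -
  let ?J = "(1 / (2 * pi * L)) *\<^sub>R momentum \<Gamma> X"
  have rhs: "(1 / (2 * pi)) *\<^sub>R (\<Sum>p | p \<noteq> r. (\<Gamma> p / ((hinner (X$p) (X$r))\<^sup>2 - 1)) *\<^sub>R X$p)
      + (l / \<Gamma> r) *\<^sub>R X$r = ?J + (l / \<Gamma> r - \<Gamma> r / (2 * pi * L)) *\<^sub>R X$r" for r l
    by (subst weighted_sum_others[where L = L]) (auto simp: L algebra_simps)
  show ?thesis
    unfolding is_angular_velocity_def rhs
  proof
    assume "\<exists>l. \<forall>r. \<xi> = ?J + (l r / \<Gamma> r - \<Gamma> r / (2 * pi * L)) *\<^sub>R X$r"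
    then obtain l where l: "\<And>r. \<xi> = ?J + (l r / \<Gamma> r - \<Gamma> r / (2 * pi * L)) *\<^sub>R X$r" by blast
    define c where "c r = l r / \<Gamma> r - \<Gamma> r / (2 * pi * L)" for r
    have c: "\<xi> = ?J + c r *\<^sub>R X$r" for r
      using l by (simp add: c_def)
    \<comment> \<open>Two vertices suffice: the same shift of \<xi> would be a multiple of both
      \<open>X$1\<close> and \<open>X$2\<close>, which are linearly independent.\<close>
    then have "c 1 *\<^sub>R X$1 = c 2 *\<^sub>R X$2" by (metis add_left_imp_eq)
    then have "c 1 = 0"
      using X by (intro hyperbolic_scale_eq_0[of "X$1" "X$2" "c 1" "c 2"]) (auto simp: phase_space_def)
    then show "\<xi> = ?J" using c[of 1] by simp
  next
    assume "\<xi> = ?J"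
    then show "\<exists>l. \<forall>r. \<xi> = ?J + (l r / \<Gamma> r - \<Gamma> r / (2 * pi * L)) *\<^sub>R X$r"
      \<comment> \<open>These multipliers restore exactly the self-term missing from each
        sum.\<close>
      using \<Gamma> by (intro exI[of _ "\<lambda>r. \<Gamma> r * \<Gamma> r / (2 * pi * L)"]) simp
  qed
qed

theorem theorem4:
  fixes \<Gamma> :: "3 \<Rightarrow> real" and X :: "real^3^3"
  assumes "\<forall>r. \<Gamma> r \<noteq> 0"
    and "X \<in> phase_space"
    and "equilateral X"
  shows "relative_equilibrium \<Gamma> X \<and>
    (\<exists>L. (\<forall>i j. i \<noteq> j \<longrightarrow> L = (hinner (X$i) (X$j))\<^sup>2 - 1) \<and>
         (\<forall>\<xi>. is_angular_velocity \<Gamma> X \<xi> \<longleftrightarrow> \<xi> = (1 / (2 * pi * L)) *\<^sub>R momentum \<Gamma> X))"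
proof (intro conjI exI allI impI)
  let ?L = "(hinner (X$1) (X$2))\<^sup>2 - 1"
  show "relative_equilibrium \<Gamma> X"
    by (rule equilateral_relative_equilibrium[OF assms(2,3)])
  show L: "?L = (hinner (X$i) (X$j))\<^sup>2 - 1" if "i \<noteq> j" for i j
    by (simp add: equilateral_hinner_eq[OF assms(2,3) that])
  show "is_angular_velocity \<Gamma> X \<xi> \<longleftrightarrow> \<xi> = (1 / (2 * pi * ?L)) *\<^sub>R momentum \<Gamma> X" for \<xi>
    by (rule equilateral_angular_velocity[OF assms(1,2)]) (simp add: L)
qed

end
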